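(* Let $G$ be an $(n,d,\lambda)$-graph with $d=o(n)$, and let $U\subset V(G)$ be a set of vertices. Assume that: (1) given any three vertices $v_1,v_2,v_3\in U$, there exist three vertices $u_1,u_2,u_3\in U$ such that $u_i\sim v_j$ if and only if $i=j$; (2) $|U|\ge C\max\left\{\lambda^{2/3}(n/d)^2,\ \lambda (n/d)^{13/7}\right\}$, where $C$ is a (sufficiently large) absolute constant. Then the VC-dimension of $\mathcal{H}(U)$ is at least $3$.
   Context: An $(n,d,\lambda)$-graph is a $d$-regular graph on $n$ vertices all of whose adjacency eigenvalues other than the largest have absolute value at most $\lambda$. We write $u\sim v$ if $u$ and $v$ are adjacent. Asymptotic notation refers to a sequence of such graphs with $n\to\infty$. For $U\subset V(G)$ and $v\in U$, let $h_v\colon U\to\{0,1\}$ be given by $h_v(u)=1$ if $u\sim v$ and $h_v(u)=0$ otherwise ($u\in U$), and $\mathcal{H}(U)=\{h_v: v\in U\}$. A collection $\mathcal{H}$ of functions $V\to\{0,1\}$ shatters a finite set $X\subset V$ if the restrictions of the functions in $\mathcal{H}$ to $X$ give every function $X\to\{0,1\}$; the VC-dimension of $\mathcal{H}$ is the largest size of a set shattered by $\mathcal{H}$. *)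

theory Defs
  imports
    "Jordan_Normal_Form.Char_Poly"
    "HOL-Library.Extended_Nat"
    "HOL-Library.FuncSet"
    "HOL-Library.Landau_Symbols"
begin

text \<open>
  A graph on \<open>n\<close> vertices is represented with vertex set \<open>{..<n}\<close> and an adjacency relation on it.
\<close>

definition simple_graph :: "nat \<Rightarrow> (nat \<Rightarrow> nat \<Rightarrow> bool) \<Rightarrow> bool" where
  "simple_graph n adj \<longleftrightarrow>
     (\<forall>u v. adj u v \<longrightarrow> u < n \<and> v < n \<and> u \<noteq> v) \<and>
     (\<forall>u v. adj u v \<longrightarrow> adj v u)"

definition regular_graph :: "nat \<Rightarrow> nat \<Rightarrow> (nat \<Rightarrow> nat \<Rightarrow> bool) \<Rightarrow> bool" where
  "regular_graph n d adj \<longleftrightarrow> simple_graph n adj \<and> (\<forall>v<n. card {u. adj v u} = d)"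

definition adjacency_mat :: "nat \<Rightarrow> (nat \<Rightarrow> nat \<Rightarrow> bool) \<Rightarrow> real mat" where
  "adjacency_mat n adj = mat n n (\<lambda>(i, j). if adj i j then 1 else 0)"

text \<open>
  Eigenvalues are counted with multiplicity. The matrix is real symmetric, so its characteristic
  polynomial splits over the reals and the multiset of real roots contains all \<open>n\<close> eigenvalues.
\<close>

definition adjacency_eigenvalues :: "nat \<Rightarrow> (nat \<Rightarrow> nat \<Rightarrow> bool) \<Rightarrow> real multiset" where
  "adjacency_eigenvalues n adj = proots (char_poly (adjacency_mat n adj))"

text \<open>
  Only one copy of the largest eigenvalue is exempt from the bound: if it is repeated (as for
  disconnected graphs), it must itself be at most \<open>l\<close> in absolute value.
\<close>

definition ndl_graph :: "nat \<Rightarrow> nat \<Rightarrow> real \<Rightarrow> (nat \<Rightarrow> nat \<Rightarrow> bool) \<Rightarrow> bool" where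
  "ndl_graph n d l adj \<longleftrightarrow> regular_graph n d adj \<and>
     (\<forall>\<mu> \<in># adjacency_eigenvalues n adj - {#Max_mset (adjacency_eigenvalues n adj)#}. \<bar>\<mu>\<bar> \<le> l)"

text \<open>
  Functions \<open>V \<rightarrow> {0, 1}\<close> are elements of \<open>V \<rightarrow>\<^sub>E {0, 1}\<close>, that is, undefined outside \<open>V\<close>.
\<close>

definition nbr_fun :: "(nat \<Rightarrow> nat \<Rightarrow> bool) \<Rightarrow> nat set \<Rightarrow> nat \<Rightarrow> nat \<Rightarrow> nat" where
  "nbr_fun adj U v = (\<lambda>u\<in>U. if adj u v then 1 else 0)"

definition nbr_class :: "(nat \<Rightarrow> nat \<Rightarrow> bool) \<Rightarrow> nat set \<Rightarrow> (nat \<Rightarrow> nat) set" where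
  "nbr_class adj U = nbr_fun adj U ` U"

definition shatters :: "('a \<Rightarrow> nat) set \<Rightarrow> 'a set \<Rightarrow> bool" where
  "shatters H X \<longleftrightarrow> (\<lambda>h. restrict h X) ` H = X \<rightarrow>\<^sub>E {0, 1}"

text \<open>
  The supremum in \<open>enat\<close> is infinite if arbitrarily large finite sets are shattered, and \<open>0\<close> if
  no set is shattered (which happens only for empty \<open>H\<close>).
\<close>

definition vc_dim :: "'a set \<Rightarrow> ('a \<Rightarrow> nat) set \<Rightarrow> enat" where
  "vc_dim V H = Sup {enat (card X) | X. finite X \<and> X \<subseteq> V \<and> shatters H X}"

end

theory Submission
  imports
    Defs
    "Jordan_Normal_Form.Schur_Decomposition"
    "Jordan_Normal_Form.Spectral_Radius"
begin

text \<open>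
  Write \<open>p = d / n\<close> and \<open>N = |U|\<close>. The deflated matrix \<open>A - p J\<close> has operator norm at most \<open>\<lambda>\<close>, so
  \<open>\<Sum>\<^sub>u (|N(u) \<inter> W| - p |W|)\<^sup>2 \<le> \<lambda>\<^sup>2 |W|\<close> for every vertex set \<open>W\<close>; this is the only use of the spectrum.
  All but few vertices of \<open>U\<close> have about \<open>p N\<close> neighbours in \<open>U\<close>, which gives on the order of
  \<open>p\<^sup>3 N\<^sup>4\<close> quadruples \<open>(y, a, b, c)\<close> in \<open>U\<close> with \<open>y\<close> adjacent to the typical vertices \<open>a, b, c\<close>.
  By hypothesis (1) such a triple can fail to be shattered only if the common neighbourhood \<open>S\<close> in \<open>U\<close> of two of
  its members lies in the neighbourhood of the third. Given the two, there are \<open>|S|\<close> choices of \<open>y\<close>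
  and, by the discrepancy bound for \<open>W = S\<close>, only \<open>O(\<lambda>\<^sup>2 / |S|)\<close> of the third vertex, hence
  \<open>O(\<lambda>\<^sup>2 N\<^sup>2)\<close> bad quadruples. So \<open>N \<ge> C \<lambda> p\<^bsup>-3/2\<^esup>\<close> suffices, and this follows from the second term
  of the maximum.
\<close>

section \<open>Real symmetric matrices\<close>

text \<open>By convexity the increments are nondecreasing, so a positive first one forces at least
  linear growth, past any bound \<open>K\<close>.\<close>

lemma bounded_convex_sequence_step_le:
  fixes a :: "nat \<Rightarrow> real"
  assumes convex: "\<And>k. 2 * a (Suc k) \<le> a k + a (Suc (Suc k))"
    and bounded: "\<And>k. a k \<le> K"
  shows "a 1 \<le> a 0"
proof (rule ccontr)
  assume "\<not> a 1 \<le> a 0"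
  hence pos: "a 1 - a 0 > 0" by simp
  have step: "a (Suc k) - a k \<ge> a 1 - a 0" for k
  proof (induction k)
    case (Suc k)
    thus ?case using convex[of k] by simp
  qed simp
  have lin: "a k \<ge> a 0 + real k * (a 1 - a 0)" for k
  proof (induction k)
    case (Suc k)
    thus ?case using step[of k] by (simp add: algebra_simps)
  qed simp
  obtain k where "real k * (a 1 - a 0) > K - a 0"
    using reals_Archimedean3[OF pos] by blast
  thus False using lin[of k] bounded[of k] by simp
qed

lemma mult_mat_vec_index_sum:
  fixes M :: "'a :: semiring_0 mat"
  assumes "M \<in> carrier_mat m n" "v \<in> carrier_vec n" "i < m"
  shows "(M *\<^sub>v v) $ i = (\<Sum>j<n. M $$ (i, j) * v $ j)"
  using assms by (auto simp: scalar_prod_def atLeast0LessThan intro!: sum.cong)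

lemma symmetric_mat_scalar_prod:
  fixes S :: "'a :: comm_semiring_0 mat"
  assumes "S \<in> carrier_mat n n" "S\<^sup>T = S" "x \<in> carrier_vec n" "y \<in> carrier_vec n"
  shows "(S *\<^sub>v x) \<bullet> y = x \<bullet> (S *\<^sub>v y)"
  using transpose_vec_mult_scalar[of S n n y x] assms
  by (metis comm_scalar_prod mult_mat_vec_carrier)

text \<open>The spectral radius lives over the complex numbers, the eigenvalue hypotheses below over
  the reals; this is the bridge. Moving \<open>S\<close> across the product with
  \<open>conjugate v\<close> gives \<open>z = cnj z\<close>, and a real root of the complexified
  characteristic polynomial is a root of the real one.\<close>

lemma real_symmetric_complex_eigenvalue:
  fixes S :: "real mat"
  assumes S: "S \<in> carrier_mat n n" and sym: "S\<^sup>T = S"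
    and ev: "eigenvalue (map_mat complex_of_real S) z"
  obtains x where "z = complex_of_real x" "eigenvalue S x"
proof -
  let ?S = "map_mat complex_of_real S"
  have SC: "?S \<in> carrier_mat n n" using S by simp
  obtain v where v: "v \<in> carrier_vec n" "v \<noteq> 0\<^sub>v n" "?S *\<^sub>v v = z \<cdot>\<^sub>v v"
    using ev S unfolding eigenvalue_def eigenvector_def by auto
  have cS: "conjugate (?S *\<^sub>v v) = ?S *\<^sub>v conjugate v"
    using S v(1) by (intro eq_vecI) (auto simp: scalar_prod_def)
  have symC: "?S\<^sup>T = ?S" using sym by (simp add: map_mat_transpose)
  have cv: "conjugate v \<in> carrier_vec n" using v(1) by simp
  have "z * (v \<bullet> conjugate v) = (?S *\<^sub>v v) \<bullet> conjugate v"
    using v cv by simp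
  also have "\<dots> = v \<bullet> (?S *\<^sub>v conjugate v)"
    by (rule symmetric_mat_scalar_prod[OF SC symC v(1) cv])
  also have "\<dots> = v \<bullet> conjugate (z \<cdot>\<^sub>v v)" unfolding cS[symmetric] v(3) ..
  also have "conjugate (z \<cdot>\<^sub>v v) = cnj z \<cdot>\<^sub>v conjugate v"
    using v(1) by (intro eq_vecI) auto
  also have "v \<bullet> (cnj z \<cdot>\<^sub>v conjugate v) = cnj z * (v \<bullet> conjugate v)"
    using v(1) cv by simp
  finally have eq: "z * (v \<bullet> conjugate v) = cnj z * (v \<bullet> conjugate v)" .
  have "v \<bullet> conjugate v \<noteq> 0"
    using conjugate_square_eq_0_vec[OF v(1)] v(2) by simp
  hence "cnj z = z" using eq by simp
  then obtain x where x: "z = complex_of_real x"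
    by (metis complex_cnj_cancel_iff Reals_cnj_iff Reals_cases)
  have "poly (char_poly ?S) z = 0" using ev eigenvalue_root_char_poly[OF SC] by simp
  hence "poly (char_poly S) x = 0"
    using x S by (simp add: of_real_hom.char_poly_hom of_real_hom.poly_map_poly)
  thus ?thesis using that x eigenvalue_root_char_poly[OF S] by blast
qed

text \<open>
  The powers of \<open>S\<close> are bounded because its spectral radius is below \<open>1\<close>, and symmetry makes
  \<open>k \<mapsto> |S\<^sup>k v|\<^sup>2\<close> convex; a bounded convex sequence does not increase.
\<close>

lemma symmetric_mat_contraction:
  fixes S :: "real mat"
  assumes S: "S \<in> carrier_mat n n" and sym: "S\<^sup>T = S" and n: "n > 0"
    and ev: "\<And>x. eigenvalue S x \<Longrightarrow> \<bar>x\<bar> < 1"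
    and v: "v \<in> carrier_vec n"
  shows "(S *\<^sub>v v) \<bullet> (S *\<^sub>v v) \<le> v \<bullet> v"
proof -
  let ?S = "map_mat complex_of_real S"
  have SC: "?S \<in> carrier_mat n n" using S by simp
  have "spectral_radius ?S \<in> norm ` spectrum ?S"
    by (rule spectral_radius_mem_max(1)[OF SC n])
  hence "spectral_radius ?S < 1"
    using real_symmetric_complex_eigenvalue[OF S sym] ev unfolding spectrum_def
    by (smt (verit) image_iff mem_Collect_eq norm_of_real)
  then obtain c where c: "\<And>k. norm_bound (?S ^\<^sub>m k) c"
    using spectral_radius_jnf_norm_bound_less_1_upper_triangular[OF SC] by blast
  have Sk: "S ^\<^sub>m k \<in> carrier_mat n n" for k using S by simp
  have bnd: "\<bar>(S ^\<^sub>m k) $$ (i, j)\<bar> \<le> c" if "i < n" "j < n" for i j k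
  proof -
    have "?S ^\<^sub>m k = map_mat complex_of_real (S ^\<^sub>m k)"
      by (rule of_real_hom.mat_hom_pow[OF S, symmetric])
    thus ?thesis using c[of k] that S unfolding norm_bound_def by auto
  qed
  define w where "w k = S ^\<^sub>m k *\<^sub>v v" for k
  have w: "w k \<in> carrier_vec n" for k unfolding w_def by (rule mult_mat_vec_carrier[OF Sk v])
  have wSuc: "w (Suc k) = S *\<^sub>v w k" for k
  proof -
    have "S ^\<^sub>m Suc k = S * S ^\<^sub>m k"
    proof (induction k)
      case 0
      thus ?case using S by simp
    next
      case (Suc k)
      have "S ^\<^sub>m Suc (Suc k) = S * S ^\<^sub>m k * S"
        using Suc by (metis pow_mat.simps(2))
      thus ?case using assoc_mult_mat[OF S Sk S] by simp
    qed
    thus ?thesis unfolding w_def using assoc_mult_mat_vec[OF S Sk v] by simp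
  qed
  define a where "a k = w k \<bullet> w k" for k
  \<comment> \<open>\<open>c\<close> bounds the entries of every power of \<open>S\<close>, so
    \<open>M\<close> bounds \<open>a k\<close> for all \<open>k\<close> at once.\<close>
  define M where "M = (\<Sum>i<n. (\<Sum>j<n. c * \<bar>v $ j\<bar>)\<^sup>2)"
  have "a 1 \<le> a 0"
  proof (rule bounded_convex_sequence_step_le)
    fix k
    \<comment> \<open>Moving one factor \<open>S\<close> across makes \<open>a (Suc k)\<close> the
      inner product of \<open>w k\<close> and \<open>w (Suc (Suc k))\<close>; convexity is then
      nonnegativity of the squared length of their difference.\<close>
    have aSuc: "a (Suc k) = w k \<bullet> w (Suc (Suc k))"
      unfolding a_def wSuc by (rule symmetric_mat_scalar_prod[OF S sym]) (use w S in auto)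
    have "0 \<le> (w k - w (Suc (Suc k))) \<bullet> (w k - w (Suc (Suc k)))"
      by (simp add: scalar_prod_def sum_nonneg)
    also have "\<dots> = a k - 2 * a (Suc k) + a (Suc (Suc k))"
      unfolding aSuc unfolding a_def
      using w[of k] w[of "Suc (Suc k)"] comm_scalar_prod[OF w[of k] w[of "Suc (Suc k)"]]
      by (simp add: minus_scalar_prod_distrib[of _ n] scalar_prod_minus_distrib[of _ n])
    finally show "2 * a (Suc k) \<le> a k + a (Suc (Suc k))" by simp
  next
    fix k
    have "\<bar>w k $ i\<bar> \<le> (\<Sum>j<n. c * \<bar>v $ j\<bar>)" if "i < n" for i
    proof -
      have "w k $ i = (\<Sum>j<n. (S ^\<^sub>m k) $$ (i, j) * v $ j)"
        unfolding w_def by (rule mult_mat_vec_index_sum[OF Sk v that])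
      also have "\<bar>\<dots>\<bar> \<le> (\<Sum>j<n. \<bar>(S ^\<^sub>m k) $$ (i, j) * v $ j\<bar>)" by (rule sum_abs)
      also have "\<dots> \<le> (\<Sum>j<n. c * \<bar>v $ j\<bar>)"
        using bnd[OF that] by (intro sum_mono) (auto simp: abs_mult intro!: mult_right_mono)
      finally show ?thesis .
    qed
    hence "\<bar>w k $ i\<bar>\<^sup>2 \<le> (\<Sum>j<n. c * \<bar>v $ j\<bar>)\<^sup>2" if "i < n" for i
      using that by (intro power_mono) auto
    hence "(\<Sum>i<n. (w k $ i)\<^sup>2) \<le> M"
      unfolding M_def by (intro sum_mono) auto
    thus "a k \<le> M" unfolding a_def using w[of k]
      by (simp add: scalar_prod_def atLeast0LessThan power2_eq_square)
  qed
  moreover have "w 0 = v" unfolding w_def using S v by simp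
  moreover have "w 1 = S *\<^sub>v v" unfolding w_def using S v by simp
  ultimately show ?thesis unfolding a_def by simp
qed

text \<open>Dividing \<open>S\<close> by any \<open>t > L\<close> puts all eigenvalues strictly
  between -1 and 1, as the contraction lemma demands; then \<open>t\<close> tends to
  \<open>L\<close> from above. The limit also covers \<open>L = 0\<close>, where dividing by
  \<open>L\<close> itself is impossible.\<close>

lemma symmetric_mat_norm_le:
  fixes S :: "real mat"
  assumes S: "S \<in> carrier_mat n n" and sym: "S\<^sup>T = S" and n: "n > 0" and L: "L \<ge> 0"
    and ev: "\<And>x. eigenvalue S x \<Longrightarrow> \<bar>x\<bar> \<le> L"
    and v: "v \<in> carrier_vec n"
  shows "(S *\<^sub>v v) \<bullet> (S *\<^sub>v v) \<le> L\<^sup>2 * (v \<bullet> v)"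
proof -
  have scaled: "(S *\<^sub>v v) \<bullet> (S *\<^sub>v v) \<le> t\<^sup>2 * (v \<bullet> v)" if t: "t > L" for t
  proof -
    let ?T = "(1 / t) \<cdot>\<^sub>m S"
    have t0: "t > 0" using t L by simp
    have "?T\<^sup>T = (1 / t) \<cdot>\<^sub>m S\<^sup>T" by (intro eq_matI) auto
    hence T: "?T \<in> carrier_mat n n" "?T\<^sup>T = ?T" using S sym by auto
    have Tv: "?T *\<^sub>v w = (1 / t) \<cdot>\<^sub>v (S *\<^sub>v w)" if "w \<in> carrier_vec n" for w
      using S that by auto
    have "\<bar>x\<bar> < 1" if x: "eigenvalue ?T x" for x
    proof -
      obtain w where w: "w \<in> carrier_vec n" "w \<noteq> 0\<^sub>v n" "?T *\<^sub>v w = x \<cdot>\<^sub>v w"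
        using x S unfolding eigenvalue_def eigenvector_def by auto
      have "S *\<^sub>v w = t \<cdot>\<^sub>v ((1 / t) \<cdot>\<^sub>v (S *\<^sub>v w))"
        using t0 S w(1) by (intro eq_vecI) auto
      also have "\<dots> = (t * x) \<cdot>\<^sub>v w" using w Tv by (simp add: smult_smult_assoc)
      finally have "eigenvalue S (t * x)"
        using w S unfolding eigenvalue_def eigenvector_def by auto
      hence "t * \<bar>x\<bar> \<le> L" using ev t0 by (metis abs_mult abs_of_pos)
      hence "t * \<bar>x\<bar> < t * 1" using t by simp
      thus ?thesis using t0 mult_less_cancel_left_pos by blast
    qed
    from symmetric_mat_contraction[OF T n this v]
    have "(1 / t)\<^sup>2 * ((S *\<^sub>v v) \<bullet> (S *\<^sub>v v)) \<le> v \<bullet> v"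
      unfolding Tv[OF v] using S v by (simp add: power2_eq_square)
    thus ?thesis using t0 by (simp add: field_simps)
  qed
  have "((\<lambda>t. t\<^sup>2 * (v \<bullet> v)) \<longlongrightarrow> L\<^sup>2 * (v \<bullet> v)) (at_right L)"
    by (intro tendsto_intros)
  moreover have "\<forall>\<^sub>F t in at_right L. (S *\<^sub>v v) \<bullet> (S *\<^sub>v v) \<le> t\<^sup>2 * (v \<bullet> v)"
    using scaled by (auto simp: eventually_at_filter)
  ultimately show ?thesis
    by (intro tendsto_lowerbound) auto
qed

text \<open>As \<open>e = x\<close> is allowed, the product of linear factors is there to record
  multiplicity. In an orthogonal basis starting with \<open>u\<close> the first column of the matrix
  is \<open>e\<close> followed by zeros, so the characteristic polynomial splits off
  \<open>[:-e, 1:]\<close>. Orthogonality makes the first coordinate of \<open>v\<close> vanish, and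
  its remaining coordinates form an eigenvector of the lower right block \<open>A3\<close> for
  \<open>x\<close>.\<close>

lemma char_poly_orthogonal_eigenvectors_dvd:
  fixes A :: "real mat"
  assumes A: "A \<in> carrier_mat n n"
    and u: "u \<in> carrier_vec n" "u \<noteq> 0\<^sub>v n" "A *\<^sub>v u = e \<cdot>\<^sub>v u"
    and v: "v \<in> carrier_vec n" "v \<noteq> 0\<^sub>v n" "A *\<^sub>v v = x \<cdot>\<^sub>v v"
    and uv: "u \<bullet> v = 0"
  shows "[:-e, 1:] * [:-x, 1:] dvd char_poly A"
proof -
  have n: "n \<noteq> 0" using u(1,2) by (intro notI) auto
  interpret cof_vec_space n "TYPE(real)" .
  define b where "b = basis_completion u"
  define ws where "ws = gram_schmidt n b"
  define W where "W = mat_of_cols n ws"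
  define W' where "W' = corthogonal_inv W"
  define A' where "A' = W' * A * W"
  from basis_completion[OF u(1,2), folded b_def]
  have dist_b: "distinct b" and indep: "\<not> lin_dep (set b)" and b: "set b \<subseteq> carrier_vec n"
    and hdb: "hd b = u" and len_b: "length b = n" by auto
  from hdb len_b n obtain vs where bv: "b = u # vs" by (cases b) auto
  from gram_schmidt_result[OF b dist_b indep refl, folded ws_def]
  have ws: "set ws \<subseteq> carrier_vec n" "corthogonal ws" "length ws = n" by (auto simp: len_b)
  from gram_schmidt_hd[OF u(1), of vs, folded bv] have hdws: "hd ws = u" unfolding ws_def .
  hence ws0: "ws ! 0 = u" using ws(3) n by (cases ws) auto
  have W: "W \<in> carrier_mat n n" using ws unfolding W_def by auto
  have W': "W' \<in> carrier_mat n n"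
    unfolding W'_def corthogonal_inv_def using W by (auto simp: mat_of_rows_def)
  have W'W: "W' * W = 1\<^sub>m n"
    using corthogonal_inv_result[OF orthogonal_mat_of_cols[OF ws]] W'
    unfolding W'_def W_def inverts_mat_def by auto
  have WW': "W * W' = 1\<^sub>m n" by (rule mat_mult_left_right_inverse[OF W' W W'W])
  have A': "A' \<in> carrier_mat n n" using W W' A unfolding A'_def by auto
  have "similar_mat_wit A' A W' W"
    by (rule similar_mat_witI[of _ _ n]) (use W W' A A' W'W WW' in \<open>auto simp: A'_def\<close>)
  hence sim: "char_poly A' = char_poly A"
    by (intro char_poly_similar) (auto simp: similar_mat_def)
  have col0: "col A' 0 = vec n (\<lambda>i. if i = 0 then e else 0)"
    unfolding A'_def W'_def W_def by (rule corthogonal_col_ev_0[OF A u n hdws ws])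
  have A'0: "A' $$ (i, 0) = (if i = 0 then e else 0)" if "i < n" for i
    using arg_cong[OF col0, of "\<lambda>w. w $ i"] A' that by auto
  define w where "w = W' *\<^sub>v v"
  have w: "w \<in> carrier_vec n" unfolding w_def using W' v by auto
  have Ww: "W *\<^sub>v w = v"
    unfolding w_def using W W' v WW' by (simp add: assoc_mult_mat_vec[symmetric, of _ n n _ n])
  have A'w: "A' *\<^sub>v w = x \<cdot>\<^sub>v w"
  proof -
    have "A' *\<^sub>v w = W' *\<^sub>v (A *\<^sub>v (W *\<^sub>v w))"
      unfolding A'_def using W W' A w by (simp add: assoc_mult_mat_vec[of _ n n _ n])
    also have "\<dots> = W' *\<^sub>v (x \<cdot>\<^sub>v v)" unfolding Ww v(3) ..
    also have "\<dots> = x \<cdot>\<^sub>v w" unfolding w_def using W' v(1) by (intro eq_vecI) auto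
    finally show ?thesis .
  qed
  \<comment> \<open>The columns of \<open>W\<close> are orthogonal, so row 0 of its inverse is a
    multiple of \<open>u\<close>; hence coordinate 0 of \<open>w\<close> is a multiple of
    \<open>u \<bullet> v\<close>.\<close>
  have w0: "w $ 0 = 0"
  proof -
    have "conjugate u = u" by (intro eq_vecI) auto
    have "row W' 0 = vec_inv u"
      unfolding W'_def W_def corthogonal_inv_def using n ws(1,3) ws0 u(1)
      by (auto simp: mat_of_rows_row)
    hence "w $ 0 = vec_inv u \<bullet> v" unfolding w_def using W' n by auto
    also have "\<dots> = 0"
      unfolding vec_inv_def using \<open>conjugate u = u\<close> u v uv by simp
    finally show ?thesis .
  qed
  obtain A1 A2 A0 A3 where split: "split_block A' 1 1 = (A1, A2, A0, A3)"
    by (cases "split_block A' 1 1")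
  from A' n have "dim_row A' = 1 + (n - 1)" "dim_col A' = 1 + (n - 1)" by auto
  from split_block[OF split this] have A1: "A1 \<in> carrier_mat 1 1"
    and A2: "A2 \<in> carrier_mat 1 (n - 1)"
    and A3: "A3 \<in> carrier_mat (n - 1) (n - 1)"
    and block: "A' = four_block_mat A1 A2 A0 A3" by auto
  have A1id: "A1 = mat 1 1 (\<lambda>_. e)"
    using split[unfolded split_block_def Let_def] A'0 n by auto
  have A0id: "A0 = 0\<^sub>m (n - 1) 1"
    using split[unfolded split_block_def Let_def] A'0 A' by auto
  have A3id: "A3 $$ (i, j) = A' $$ (Suc i, Suc j)" if "i < n - 1" "j < n - 1" for i j
    using split[unfolded split_block_def Let_def] A' that by auto
  have "char_poly A' = char_poly A1 * char_poly A3"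
    unfolding block A0id by (rule char_poly_four_block_zeros_col[OF A1 A2 A3])
  also have "char_poly A1 = [:-e, 1:]"
    by (simp add: A1id char_poly_defs det_def sign_def)
  finally have cp: "char_poly A = [:-e, 1:] * char_poly A3" unfolding sim .
  define w3 where "w3 = vec (n - 1) (\<lambda>i. w $ Suc i)"
  have w3: "w3 \<in> carrier_vec (n - 1)" unfolding w3_def by auto
  have "w3 \<noteq> 0\<^sub>v (n - 1)"
  proof
    assume z: "w3 = 0\<^sub>v (n - 1)"
    have "w = 0\<^sub>v n"
    proof (rule eq_vecI)
      fix i assume i: "i < dim_vec (0\<^sub>v n)"
      show "w $ i = 0\<^sub>v n $ i"
      proof (cases i)
        case (Suc j)
        thus ?thesis using arg_cong[OF z, of "\<lambda>w. w $ j"] i unfolding w3_def by auto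
      qed (use w0 i in auto)
    qed (use w in auto)
    hence "v = 0\<^sub>v n" using Ww W by auto
    thus False using v by simp
  qed
  moreover have "A3 *\<^sub>v w3 = x \<cdot>\<^sub>v w3"
  proof (rule eq_vecI)
    fix i assume "i < dim_vec (x \<cdot>\<^sub>v w3)"
    hence i: "i < n - 1" using w3 by auto
    have "x * w $ Suc i = (A' *\<^sub>v w) $ Suc i" using A'w w i by auto
    also have "\<dots> = (\<Sum>j\<in>{0..<n}. A' $$ (Suc i, j) * w $ j)"
      using A' w i by (auto simp: scalar_prod_def intro!: sum.cong)
    also have "\<dots> = (\<Sum>j\<in>{0..<Suc (n - 1)}. A' $$ (Suc i, j) * w $ j)" using n by simp
    also have "\<dots> = (\<Sum>j\<in>{0..<n - 1}. A' $$ (Suc i, Suc j) * w $ Suc j)"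
      by (subst sum.atLeast0_lessThan_Suc_shift) (simp add: w0)
    also have "\<dots> = (A3 *\<^sub>v w3) $ i"
      using A3 w3 i A3id by (auto simp: scalar_prod_def w3_def intro!: sum.cong)
    finally show "(A3 *\<^sub>v w3) $ i = (x \<cdot>\<^sub>v w3) $ i" using i by (simp add: w3_def)
  qed (use A3 w3 in auto)
  ultimately have "eigenvalue A3 x"
    using A3 w3 unfolding eigenvalue_def eigenvector_def by auto
  hence "[:-x, 1:] dvd char_poly A3"
    using eigenvalue_root_char_poly[OF A3] by (simp add: poly_eq_0_iff_dvd)
  thus ?thesis unfolding cp by (rule mult_dvd_mono[OF dvd_refl])
qed

section \<open>Discrepancy of regular graphs\<close>

lemma adjacency_mat_mult_vec_index:
  assumes "v \<in> carrier_vec n" "i < n"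
  shows "(adjacency_mat n adj *\<^sub>v v) $ i = (\<Sum>j<n. if adj i j then v $ j else 0)"
  using assms unfolding adjacency_mat_def
  by (auto simp: scalar_prod_def atLeast0LessThan intro!: sum.cong)

lemma regular_graph_nbrs:
  assumes "regular_graph n d adj" "i < n"
  shows "{u. adj i u} \<subseteq> {..<n}" "card {u. adj i u} = d"
  using assms unfolding regular_graph_def simple_graph_def by auto

lemma regular_graph_adj_sum:
  assumes "regular_graph n d adj" "i < n"
  shows "(\<Sum>j<n. if adj i j then c else (0::real)) = real d * c"
proof -
  have "(\<Sum>j<n. if adj i j then c else 0) = (\<Sum>j\<in>{..<n} \<inter> {u. adj i u}. c)"
    by (simp add: sum.If_cases)
  also have "{..<n} \<inter> {u. adj i u} = {u. adj i u}" using regular_graph_nbrs(1)[OF assms] by blast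
  finally show ?thesis using regular_graph_nbrs(2)[OF assms] by simp
qed

text \<open>Maximum principle: the eigenvector equation is read at a coordinate of largest absolute
  value, where the \<open>d\<close> neighbours contribute at most \<open>d\<close> times that value.
  This identifies \<open>d\<close> as the largest eigenvalue, the one exempt from the bound.\<close>

lemma regular_graph_eigenvalue_le:
  assumes reg: "regular_graph n d adj" and ev: "eigenvalue (adjacency_mat n adj) x"
  shows "\<bar>x\<bar> \<le> real d"
proof -
  obtain v where v: "v \<in> carrier_vec n" "v \<noteq> 0\<^sub>v n" "adjacency_mat n adj *\<^sub>v v = x \<cdot>\<^sub>v v"
    using ev unfolding eigenvalue_def eigenvector_def by (auto simp: adjacency_mat_def)
  have "n \<noteq> 0" using v(1,2) by (intro notI) auto
  hence "Max ((\<lambda>j. \<bar>v $ j\<bar>) ` {..<n}) \<in> (\<lambda>j. \<bar>v $ j\<bar>) ` {..<n}" by (intro Max_in) auto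
  then obtain i where i: "i < n" and "Max ((\<lambda>j. \<bar>v $ j\<bar>) ` {..<n}) = \<bar>v $ i\<bar>" by auto
  hence max: "\<bar>v $ j\<bar> \<le> \<bar>v $ i\<bar>" if "j < n" for j
    using that by (metis Max_ge finite_imageI finite_lessThan image_eqI lessThan_iff)
  obtain k where "k < n" "v $ k \<noteq> 0" using v(1,2) by (metis carrier_vecD eq_vecI index_zero_vec)
  hence pos: "\<bar>v $ i\<bar> > 0" using max[of k] by simp
  have "\<bar>x\<bar> * \<bar>v $ i\<bar> = \<bar>(adjacency_mat n adj *\<^sub>v v) $ i\<bar>"
    using v i by (simp add: abs_mult)
  also have "\<dots> = \<bar>\<Sum>j<n. if adj i j then v $ j else 0\<bar>"
    using adjacency_mat_mult_vec_index[OF v(1) i] by simp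
  also have "\<dots> \<le> (\<Sum>j<n. \<bar>if adj i j then v $ j else 0\<bar>)" by (rule sum_abs)
  also have "\<dots> \<le> (\<Sum>j<n. if adj i j then \<bar>v $ i\<bar> else 0)"
    using max by (intro sum_mono) auto
  also have "\<dots> = real d * \<bar>v $ i\<bar>" by (rule regular_graph_adj_sum[OF reg i])
  finally show ?thesis using pos by simp
qed

lemma adjacency_eigenvalue_iff:
  "x \<in># adjacency_eigenvalues n adj \<longleftrightarrow> eigenvalue (adjacency_mat n adj) x"
proof -
  have A: "adjacency_mat n adj \<in> carrier_mat n n" by (simp add: adjacency_mat_def)
  have "char_poly (adjacency_mat n adj) \<noteq> 0" using degree_monic_char_poly[OF A] by auto
  thus ?thesis unfolding adjacency_eigenvalues_def eigenvalue_root_char_poly[OF A] by simp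
qed

definition deflated_adjacency_mat :: "nat \<Rightarrow> nat \<Rightarrow> (nat \<Rightarrow> nat \<Rightarrow> bool) \<Rightarrow> real mat" where
  "deflated_adjacency_mat n d adj =
     mat n n (\<lambda>(i, j). (if adj i j then 1 else 0) - real d / real n)"

lemma deflated_adjacency_mat_mult_vec_index:
  assumes "v \<in> carrier_vec n" "i < n"
  shows "(deflated_adjacency_mat n d adj *\<^sub>v v) $ i =
    (\<Sum>j<n. if adj i j then v $ j else 0) - real d / real n * (\<Sum>j<n. v $ j)"
proof -
  have "(deflated_adjacency_mat n d adj *\<^sub>v v) $ i =
    (\<Sum>j<n. ((if adj i j then 1 else 0) - real d / real n) * v $ j)"
    using assms unfolding deflated_adjacency_mat_def
    by (auto simp: scalar_prod_def atLeast0LessThan intro!: sum.cong)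
  also have "\<dots> = (\<Sum>j<n. (if adj i j then v $ j else 0) - real d / real n * v $ j)"
    by (intro sum.cong) (auto simp: algebra_simps)
  finally show ?thesis by (simp add: sum_subtractf sum_distrib_left)
qed

lemma deflated_adjacency_mat_symmetric:
  assumes "simple_graph n adj"
  shows "(deflated_adjacency_mat n d adj)\<^sup>T = deflated_adjacency_mat n d adj"
  using assms unfolding deflated_adjacency_mat_def simple_graph_def
  by (intro eq_matI) auto

text \<open>An eigenvector for \<open>x \<noteq> 0\<close> is orthogonal to the all-ones vector
  \<open>u\<close>, because the symmetric matrix \<open>?B\<close> kills \<open>u\<close>. On such
  vectors \<open>?A\<close> and \<open>?B\<close> agree, so \<open>x\<close> is an adjacency
  eigenvalue in addition to \<open>d\<close>. The \<open>max\<close> provides for the eigenvalue 0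
  of \<open>u\<close>, as \<open>l\<close> is not assumed nonnegative.\<close>

lemma deflated_adjacency_mat_eigenvalue_le:
  assumes G: "ndl_graph n d l adj" and ev: "eigenvalue (deflated_adjacency_mat n d adj) x"
  shows "\<bar>x\<bar> \<le> max l 0"
proof (cases "x = 0")
  case False
  let ?A = "adjacency_mat n adj" and ?B = "deflated_adjacency_mat n d adj"
  let ?E = "adjacency_eigenvalues n adj"
  have reg: "regular_graph n d adj" using G unfolding ndl_graph_def by simp
  have A: "?A \<in> carrier_mat n n" by (simp add: adjacency_mat_def)
  have B: "?B \<in> carrier_mat n n" by (simp add: deflated_adjacency_mat_def)
  have symB: "?B\<^sup>T = ?B"
    using reg by (intro deflated_adjacency_mat_symmetric) (simp add: regular_graph_def)
  obtain v where v: "v \<in> carrier_vec n" "v \<noteq> 0\<^sub>v n" "?B *\<^sub>v v = x \<cdot>\<^sub>v v"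
    using ev B unfolding eigenvalue_def eigenvector_def by auto
  have n: "n \<noteq> 0" using v(1,2) by (intro notI) auto
  define u where "u = vec n (\<lambda>_. 1::real)"
  have u: "u \<in> carrier_vec n" unfolding u_def by simp
  have u0: "u \<noteq> 0\<^sub>v n"
    using n unfolding u_def by (metis index_vec index_zero_vec(1) neq0_conv zero_neq_one)
  have Au: "?A *\<^sub>v u = real d \<cdot>\<^sub>v u"
  proof (rule eq_vecI)
    fix i assume "i < dim_vec (real d \<cdot>\<^sub>v u)"
    hence i: "i < n" by (simp add: u_def)
    have "(?A *\<^sub>v u) $ i = (\<Sum>j<n. if adj i j then 1 else 0)"
      unfolding adjacency_mat_mult_vec_index[OF u i] by (intro sum.cong) (auto simp: u_def)
    thus "(?A *\<^sub>v u) $ i = (real d \<cdot>\<^sub>v u) $ i"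
      using regular_graph_adj_sum[OF reg i, of 1] i by (simp add: u_def)
  qed (use A in \<open>simp add: u_def\<close>)
  have Bu: "?B *\<^sub>v u = 0\<^sub>v n"
  proof (rule eq_vecI)
    fix i assume "i < dim_vec (0\<^sub>v n :: real vec)"
    hence i: "i < n" by simp
    have "(\<Sum>j<n. if adj i j then u $ j else 0) = (\<Sum>j<n. if adj i j then 1 else 0)"
      by (intro sum.cong) (auto simp: u_def)
    moreover have "(\<Sum>j<n. u $ j) = real n" by (simp add: u_def)
    ultimately show "(?B *\<^sub>v u) $ i = 0\<^sub>v n $ i"
      unfolding deflated_adjacency_mat_mult_vec_index[OF u i]
      using regular_graph_adj_sum[OF reg i, of 1] i n by simp
  qed (use B in simp)
  have "x * (u \<bullet> v) = u \<bullet> (?B *\<^sub>v v)" using u v by simp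
  also have "\<dots> = (?B *\<^sub>v u) \<bullet> v"
    by (rule symmetric_mat_scalar_prod[OF B symB u v(1), symmetric])
  also have "\<dots> = 0" unfolding Bu using v by simp
  finally have uv: "u \<bullet> v = 0" using False by simp
  hence "(\<Sum>j<n. v $ j) = 0" using v(1) by (simp add: scalar_prod_def u_def atLeast0LessThan)
  hence "?A *\<^sub>v v = ?B *\<^sub>v v"
    using A B v(1)
    by (intro eq_vecI)
      (auto simp: adjacency_mat_mult_vec_index deflated_adjacency_mat_mult_vec_index
        simp del: index_mult_mat_vec)
  hence Av: "?A *\<^sub>v v = x \<cdot>\<^sub>v v" using v(3) by simp
  obtain q where q: "char_poly ?A = [:- real d, 1:] * [:-x, 1:] * q"
    using char_poly_orthogonal_eigenvectors_dvd[OF A u u0 Au v(1,2) Av uv] by (elim dvdE)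
  have "char_poly ?A \<noteq> 0" using degree_monic_char_poly[OF A] by auto
  hence q0: "q \<noteq> 0" using q by auto
  have E: "?E = {#real d, x#} + proots q"
    unfolding adjacency_eigenvalues_def q using q0
    by (simp add: proots_mult del: mult_pCons_left mult_pCons_right)
  \<comment> \<open>The exempt copy of the largest eigenvalue is the one belonging to
    \<open>u\<close>; even if \<open>x = d\<close>, the copy of \<open>x\<close> survives its
    removal.\<close>
  have "Max_mset ?E = real d"
  proof (rule Max_eqI)
    fix y assume "y \<in> set_mset ?E"
    hence "eigenvalue ?A y" by (simp add: adjacency_eigenvalue_iff)
    thus "y \<le> real d" using regular_graph_eigenvalue_le[OF reg] by fastforce
  qed (auto simp: E)
  hence "x \<in># ?E - {#Max_mset ?E#}" unfolding E by simp
  thus ?thesis using G unfolding ndl_graph_def by fastforce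
qed simp

text \<open>The norm bound is applied to the indicator vector of \<open>W\<close>, whose squared
  length is \<open>card W\<close>; the coordinates of its image are the deviations on the
  left.\<close>

lemma ndl_graph_discrepancy:
  assumes G: "ndl_graph n d l adj" and W: "W \<subseteq> {..<n}"
  shows "(\<Sum>u<n. (real (card {w \<in> W. adj u w}) - real d / real n * real (card W))\<^sup>2)
    \<le> (max l 0)\<^sup>2 * real (card W)"
proof (cases "n = 0")
  case False
  let ?B = "deflated_adjacency_mat n d adj"
  have sg: "simple_graph n adj" using G by (simp add: ndl_graph_def regular_graph_def)
  have B: "?B \<in> carrier_mat n n" by (simp add: deflated_adjacency_mat_def)
  define v where "v = vec n (\<lambda>i. if i \<in> W then 1 else 0 :: real)"
  have v: "v \<in> carrier_vec n" unfolding v_def by simp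
  have cardW: "(\<Sum>j<n. if j \<in> W then 1 else 0) = real (card W)"
    using W by (simp add: sum.If_cases Int_absorb1)
  have vi: "(?B *\<^sub>v v) $ u = real (card {w \<in> W. adj u w}) - real d / real n * real (card W)"
    if u: "u < n" for u
  proof -
    have "(\<Sum>j<n. if adj u j then v $ j else 0) = (\<Sum>j<n. if j \<in> {w \<in> W. adj u w} then 1 else 0)"
      by (intro sum.cong) (auto simp: v_def)
    also have "\<dots> = real (card ({..<n} \<inter> {w \<in> W. adj u w}))"
      by (subst sum.If_cases) simp_all
    also have "{..<n} \<inter> {w \<in> W. adj u w} = {w \<in> W. adj u w}" using W by blast
    finally have "(\<Sum>j<n. if adj u j then v $ j else 0) = real (card {w \<in> W. adj u w})" .
    moreover have "(\<Sum>j<n. v $ j) = real (card W)"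
      unfolding cardW[symmetric] by (intro sum.cong) (auto simp: v_def)
    ultimately show ?thesis by (simp add: deflated_adjacency_mat_mult_vec_index[OF v u])
  qed
  have "(?B *\<^sub>v v) \<bullet> (?B *\<^sub>v v) \<le> (max l 0)\<^sup>2 * (v \<bullet> v)"
    using deflated_adjacency_mat_eigenvalue_le[OF G] False
    by (intro symmetric_mat_norm_le[OF B deflated_adjacency_mat_symmetric[OF sg] _ _ _ v]) auto
  moreover have "v \<bullet> v = real (card W)"
    unfolding cardW[symmetric] by (auto simp: scalar_prod_def v_def atLeast0LessThan intro!: sum.cong)
  moreover have "(?B *\<^sub>v v) \<bullet> (?B *\<^sub>v v) =
    (\<Sum>u<n. (real (card {w \<in> W. adj u w}) - real d / real n * real (card W))\<^sup>2)"
    unfolding scalar_prod_def using B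
    by (auto simp: vi atLeast0LessThan power2_eq_square simp del: index_mult_mat_vec intro!: sum.cong)
  ultimately show ?thesis by simp
qed simp

section \<open>Shattered triples\<close>

lemma shatters_nbr_class:
  assumes X: "X \<subseteq> U"
    and traces: "\<And>S. S \<subseteq> X \<Longrightarrow> \<exists>v\<in>U. \<forall>x\<in>X. adj x v \<longleftrightarrow> x \<in> S"
  shows "shatters (nbr_class adj U) X"
  unfolding shatters_def
proof (intro equalityI subsetI)
  fix f assume "f \<in> (\<lambda>h. restrict h X) ` nbr_class adj U"
  thus "f \<in> X \<rightarrow>\<^sub>E {0, 1}"
    using X unfolding nbr_class_def nbr_fun_def by auto
next
  fix f assume f: "f \<in> X \<rightarrow>\<^sub>E {0, 1 :: nat}"
  obtain v where v: "v \<in> U" "\<And>x. x \<in> X \<Longrightarrow> adj x v \<longleftrightarrow> f x = 1"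
    using traces[of "{x \<in> X. f x = 1}"] by auto
  have "restrict (nbr_fun adj U v) X = f"
  proof
    fix x
    show "restrict (nbr_fun adj U v) X x = f x"
      using v(2)[of x] f X by (cases "x \<in> X") (auto simp: nbr_fun_def PiE_def Pi_def extensional_def)
  qed
  thus "f \<in> (\<lambda>h. restrict h X) ` nbr_class adj U"
    unfolding nbr_class_def using v(1) by (metis image_eqI)
qed

lemma vc_dim_ge_cardI:
  assumes "finite X" "X \<subseteq> V" "shatters H X"
  shows "enat (card X) \<le> vc_dim V H"
  unfolding vc_dim_def by (rule Sup_upper) (use assms in blast)

section \<open>Second-moment counting under a discrepancy bound\<close>

lemma card_times_sq_le_sum:
  fixes f :: "'a \<Rightarrow> real"
  assumes "finite V" "T \<subseteq> V" "0 \<le> c" "\<And>x. x \<in> T \<Longrightarrow> c \<le> \<bar>f x\<bar>"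
  shows "real (card T) * c\<^sup>2 \<le> (\<Sum>x\<in>V. (f x)\<^sup>2)"
proof -
  have "real (card T) * c\<^sup>2 = (\<Sum>x\<in>T. c\<^sup>2)" by simp
  also have "\<dots> \<le> (\<Sum>x\<in>T. (f x)\<^sup>2)"
    using assms(3,4) by (intro sum_mono) (metis abs_le_square_iff abs_of_nonneg)
  also have "\<dots> \<le> (\<Sum>x\<in>V. (f x)\<^sup>2)"
    using assms(1,2) by (intro sum_mono2) auto
  finally show ?thesis .
qed

text \<open>The counting sees the graph only through its edge density \<open>p\<close> and a
  discrepancy constant \<open>L\<close>. The last assumption says that \<open>card U\<close> is at
  least 40 |L| p^(-3/2).\<close>

locale discrepancy_graph =
  fixes n :: nat and adj :: "nat \<Rightarrow> nat \<Rightarrow> bool" and p L :: real and U :: "nat set"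
  assumes graph: "simple_graph n adj"
    and discrepancy: "\<And>W. W \<subseteq> {..<n} \<Longrightarrow>
      (\<Sum>u<n. (real (card {w \<in> W. adj u w}) - p * real (card W))\<^sup>2) \<le> L\<^sup>2 * real (card W)"
    and p: "0 < p" "p \<le> 1 / 5"
    and U: "U \<subseteq> {..<n}" "U \<noteq> {}"
    and L: "1600 * L\<^sup>2 \<le> p ^ 3 * (real (card U))\<^sup>2"
begin

definition nbrs :: "nat \<Rightarrow> nat set" where
  "nbrs y = {w \<in> U. adj y w}"

definition atypical :: "nat set" where
  "atypical = {y \<in> U. \<bar>real (card (nbrs y)) - p * real (card U)\<bar> > p * real (card U) / 2}"

abbreviation N :: real where "N \<equiv> real (card U)"

lemma finite_U: "finite U"
  using U(1) finite_subset by blast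

lemma N_pos: "N > 0"
  using U(2) finite_U by (simp add: card_gt_0_iff)

lemma nbrs_sym: "x \<in> U \<Longrightarrow> y \<in> U \<Longrightarrow> x \<in> nbrs y \<longleftrightarrow> y \<in> nbrs x"
  using graph unfolding nbrs_def simple_graph_def by auto

lemma nbrs_subset: "nbrs y \<subseteq> U"
  by (auto simp: nbrs_def)

lemma finite_nbrs: "finite (nbrs y)"
  using nbrs_subset finite_U finite_subset by blast

text \<open>A vertex adjacent to all of \<open>S\<close> exceeds the expected degree
  \<open>p * s\<close> into \<open>S\<close> by at least \<open>s / 2\<close>. The squared
  deviations sum to at most \<open>L\<^sup>2 * s\<close>, so there are at most 4 L^2 / s such
  vertices. The product form covers empty \<open>S\<close> and is what counting pairs
  \<open>(y, c)\<close> needs.\<close>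

lemma card_common_nbrs_le:
  assumes S: "S \<subseteq> U"
  shows "real (card S) * real (card {x \<in> U. S \<subseteq> nbrs x}) \<le> 4 * L\<^sup>2"
proof (cases "S = {}")
  case False
  let ?T = "{x \<in> U. S \<subseteq> nbrs x}"
  define s where "s = real (card S)"
  have s: "s > 0" using S False finite_U finite_subset unfolding s_def by (auto simp: card_gt_0_iff)
  have "real (card ?T) * (s / 2)\<^sup>2
    \<le> (\<Sum>u\<in>{..<n}. (real (card {w \<in> S. adj u w}) - p * s)\<^sup>2)"
  proof (rule card_times_sq_le_sum)
    fix x assume "x \<in> ?T"
    hence "{w \<in> S. adj x w} = S" by (auto simp: nbrs_def)
    hence "real (card {w \<in> S. adj x w}) = s" by (simp add: s_def)
    moreover have "p * s \<le> s / 2" using p s by simp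
    ultimately show "s / 2 \<le> \<bar>real (card {w \<in> S. adj x w}) - p * s\<bar>"
      unfolding s_def[symmetric] by linarith
  qed (use U s in auto)
  also have "\<dots> \<le> L\<^sup>2 * s" unfolding s_def using S U by (intro discrepancy) auto
  finally have "s * (s * real (card ?T)) \<le> s * (4 * L\<^sup>2)"
    by (simp add: power2_eq_square field_simps)
  thus ?thesis using s unfolding s_def[symmetric] by simp
qed simp

text \<open>Discrepancy of \<open>U\<close> itself, against deviations above
  \<open>p * N / 2\<close>, leaves at most 4 L^2 / (p^2 N) vertices. The bound is a small fraction
  of \<open>p * N\<close>, not merely of \<open>N\<close>, because atypical vertices are later
  removed from single neighbourhoods.\<close>

lemma card_atypical_le: "real (card atypical) \<le> p * N / 400"
proof -
  have "real (card atypical) * (p * N / 2)\<^sup>2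
    \<le> (\<Sum>u\<in>{..<n}. (real (card {w \<in> U. adj u w}) - p * N)\<^sup>2)"
    using U p by (intro card_times_sq_le_sum) (auto simp: atypical_def nbrs_def)
  also have "\<dots> \<le> L\<^sup>2 * N" by (rule discrepancy[OF U(1)])
  also have "\<dots> \<le> (p ^ 3 * N\<^sup>2 / 1600) * N" using L by (intro mult_right_mono) auto
  also have "\<dots> = (p * N / 400) * (p * N / 2)\<^sup>2" by (simp add: power2_eq_square power3_eq_cube)
  finally show ?thesis using p N_pos by (simp add: mult_le_cancel_right)
qed

definition typical_nbrs :: "nat \<Rightarrow> nat set" where
  "typical_nbrs y = nbrs y - atypical"

lemma card_nbrs_typical:
  assumes "y \<in> U - atypical"
  shows "p * N / 2 \<le> real (card (nbrs y))" "real (card (nbrs y)) \<le> 3 / 2 * (p * N)"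
proof -
  have "\<bar>real (card (nbrs y)) - p * N\<bar> \<le> p * N / 2" using assms unfolding atypical_def by auto
  thus "p * N / 2 \<le> real (card (nbrs y))" "real (card (nbrs y)) \<le> 3 / 2 * (p * N)" by linarith+
qed

lemma card_typical_nbrs_ge:
  assumes "y \<in> U - atypical"
  shows "real (card (typical_nbrs y)) \<ge> p * N / 4"
proof -
  have fin: "finite atypical" unfolding atypical_def using finite_U by simp
  note card_nbrs_typical(1)[OF assms]
  moreover have "real (card (nbrs y)) - real (card atypical) \<le> real (card (typical_nbrs y))"
    using diff_card_le_card_Diff[OF fin, of "nbrs y"] unfolding typical_nbrs_def by linarith
  ultimately show ?thesis using card_atypical_le p N_pos by (simp add: mult_pos_pos)
qed

text \<open>
  Degenerate triples with \<open>c \<in> {a, b}\<close> are included, so triples that avoid this set are distinct.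
\<close>

definition covered :: "(nat \<times> nat \<times> nat \<times> nat) set" where
  "covered = {(y, a, b, c). y \<in> nbrs a \<inter> nbrs b \<and> a \<in> U \<and> b \<in> U \<and> c \<in> U \<and>
     nbrs a \<inter> nbrs b \<subseteq> nbrs c}"

text \<open>For a fixed pair \<open>(a, b)\<close> with common neighbourhood S, the choices of
  \<open>y\<close> in S and of \<open>c\<close> with S inside \<open>nbrs c\<close> are independent.
  Their number is the product bounded in \<open>card_common_nbrs_le\<close>, and there are N^2
  pairs.\<close>

lemma covered_finite_card:
  shows "finite covered" "real (card covered) \<le> 4 * L\<^sup>2 * N\<^sup>2"
proof -
  let ?S = "\<lambda>q. nbrs (fst q) \<inter> nbrs (snd q)"
  let ?I = "SIGMA q : U \<times> U. ?S q \<times> {c \<in> U. ?S q \<subseteq> nbrs c}"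
  let ?g = "\<lambda>((a, b), (y, c)). (y, a, b, c)"
  have fin: "finite ?I" using finite_U finite_nbrs by auto
  have sub: "covered \<subseteq> ?g ` ?I"
  proof
    fix t assume "t \<in> covered"
    then obtain y a b c where t: "t = (y, a, b, c)" "y \<in> nbrs a \<inter> nbrs b" "a \<in> U" "b \<in> U" "c \<in> U"
      "nbrs a \<inter> nbrs b \<subseteq> nbrs c" unfolding covered_def by auto
    hence "((a, b), (y, c)) \<in> ?I" by auto
    thus "t \<in> ?g ` ?I" unfolding t(1) by (intro image_eqI[of _ _ "((a, b), (y, c))"]) auto
  qed
  show "finite covered" using sub fin finite_surj by blast
  have "real (card covered) \<le> real (card ?I)"
    using sub fin by (simp add: surj_card_le)
  also have "\<dots> = (\<Sum>q\<in>U \<times> U. real (card (?S q)) * real (card {c \<in> U. ?S q \<subseteq> nbrs c}))"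
    using finite_U finite_nbrs by (subst card_SigmaI) (auto simp: card_cartesian_product)
  also have "\<dots> \<le> (\<Sum>q\<in>U \<times> U. 4 * L\<^sup>2)"
    using nbrs_subset by (intro sum_mono card_common_nbrs_le) blast
  also have "\<dots> = 4 * L\<^sup>2 * N\<^sup>2" by (simp add: card_cartesian_product power2_eq_square)
  finally show "real (card covered) \<le> 4 * L\<^sup>2 * N\<^sup>2" .
qed

text \<open>At least N/2 typical vertices \<open>y\<close> each have at least (pN/4)^3 triples of
  typical neighbours, which gives p^3 N^4 / 128 quadruples. At most 12 L^2 N^2 of them violate one
  of the three conditions, which is fewer.\<close>

lemma uncovered_triple_exists:
  obtains y a b c where "y \<in> U" "{a, b, c} \<subseteq> typical_nbrs y"
    "\<not> nbrs a \<inter> nbrs b \<subseteq> nbrs c" "\<not> nbrs a \<inter> nbrs c \<subseteq> nbrs b" "\<not> nbrs b \<inter> nbrs c \<subseteq> nbrs a"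
proof -
  let ?Q = "SIGMA y : U - atypical. typical_nbrs y \<times> typical_nbrs y \<times> typical_nbrs y"
  \<comment> \<open>The swaps bring \<open>b\<close> or \<open>a\<close> into the last position, so
    the union \<open>?bad\<close> lets each of the three vertices play the role of the third one in
    \<open>covered\<close>.\<close>
  let ?f = "\<lambda>(y, a, b, c). (y, a, c, b)" and ?g = "\<lambda>(y, a, b, c). (y, c, b, a)"
  let ?bad = "covered \<union> ?f ` covered \<union> ?g ` covered"
  have fin: "finite (typical_nbrs y)" for y
    unfolding typical_nbrs_def using finite_nbrs by simp
  have finA: "finite atypical" unfolding atypical_def using finite_U by simp
  have pN: "p * N > 0" using p N_pos by simp
  have "real (card ?bad) \<le> real (card covered + card covered + card covered)"
    using covered_finite_card(1)
    by (intro of_nat_mono order.trans[OF card_Un_le] add_mono card_image_le) auto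
  also have "\<dots> \<le> 12 * L\<^sup>2 * N\<^sup>2" using covered_finite_card(2) by simp
  also have "\<dots> \<le> 12 * (p ^ 3 * N\<^sup>2 / 1600) * N\<^sup>2"
    using L by (intro mult_right_mono mult_left_mono) auto
  also have "\<dots> = 12 / 1600 * (p ^ 3 * N ^ 4)" by (simp add: power2_eq_square power4_eq_xxxx)
  \<comment> \<open>The constant 1600 is large enough for this step: 12 * 128 = 1536 < 1600.\<close>
  also have "\<dots> < 1 / 128 * (p ^ 3 * N ^ 4)" using p N_pos by (intro mult_strict_right_mono) auto
  also have "\<dots> = N / 2 * (p * N / 4) ^ 3" by (simp add: power3_eq_cube power4_eq_xxxx)
  also have "\<dots> \<le> real (card (U - atypical)) * (p * N / 4) ^ 3"
  proof (rule mult_right_mono)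
    have "N - real (card atypical) \<le> real (card (U - atypical))"
      using diff_card_le_card_Diff[OF finA, of U] by linarith
    moreover have "p * N \<le> 1 * N" using p N_pos by (intro mult_right_mono) auto
    ultimately show "N / 2 \<le> real (card (U - atypical))" using card_atypical_le by linarith
  qed (use pN in simp)
  also have "\<dots> = (\<Sum>y\<in>U - atypical. (p * N / 4) ^ 3)" by simp
  also have "\<dots> \<le> (\<Sum>y\<in>U - atypical. real (card (typical_nbrs y)) ^ 3)"
    using card_typical_nbrs_ge pN by (intro sum_mono power_mono) auto
  also have "\<dots> = real (card ?Q)"
    using finite_U fin by (subst card_SigmaI) (auto simp: card_cartesian_product power3_eq_cube mult.assoc)
  finally have "card ?bad < card ?Q" by simp
  hence "\<not> ?Q \<subseteq> ?bad"
    using covered_finite_card(1) card_mono[of ?bad ?Q] by auto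
  then obtain y a b c where q: "(y, a, b, c) \<in> ?Q" "(y, a, b, c) \<notin> ?bad" by auto
  from q(1) have y: "y \<in> U" and abc: "{a, b, c} \<subseteq> typical_nbrs y" by auto
  have inU: "{a, b, c} \<subseteq> U" using abc nbrs_subset unfolding typical_nbrs_def by blast
  have ynb: "y \<in> nbrs a" "y \<in> nbrs b" "y \<in> nbrs c"
    using abc inU nbrs_sym[OF y] unfolding typical_nbrs_def by auto
  have "(y, a, b, c) \<notin> covered" using q(2) by blast
  moreover have "(y, a, c, b) \<notin> covered"
  proof
    assume "(y, a, c, b) \<in> covered"
    hence "?f (y, a, c, b) \<in> ?f ` covered" by (rule imageI)
    thus False using q(2) by simp
  qed
  moreover have "(y, c, b, a) \<notin> covered"
  proof
    assume "(y, c, b, a) \<in> covered"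
    hence "?g (y, c, b, a) \<in> ?g ` covered" by (rule imageI)
    thus False using q(2) by simp
  qed
  \<comment> \<open>\<open>ynb\<close> and \<open>inU\<close> supply every other condition in
    \<open>covered\<close>, so only the inclusion can fail.\<close>
  ultimately show thesis
    using inU ynb by (intro that[OF y abc]) (auto simp: covered_def)
qed

text \<open>Three typical neighbourhoods have at most 9/2 p N vertices together, and
  \<open>p \<le> 1 / 5\<close> makes this at most 9/10 of \<open>U\<close>. The vertex left over
  realises the empty trace.\<close>

lemma typical_union_nbrs:
  assumes "{a, b, c} \<subseteq> U - atypical"
  shows "\<exists>z\<in>U. z \<notin> nbrs a \<and> z \<notin> nbrs b \<and> z \<notin> nbrs c"
proof (rule ccontr)
  assume "\<not> ?thesis"
  hence "U \<subseteq> nbrs a \<union> nbrs b \<union> nbrs c" by auto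
  hence "card U \<le> card (nbrs a \<union> nbrs b \<union> nbrs c)" using finite_nbrs by (intro card_mono) auto
  also have "\<dots> \<le> card (nbrs a) + card (nbrs b) + card (nbrs c)"
    by (intro order.trans[OF card_Un_le] add_mono card_Un_le) auto
  finally have "N \<le> real (card (nbrs a)) + real (card (nbrs b)) + real (card (nbrs c))" by linarith
  also have "\<dots> \<le> 3 / 2 * (p * N) + 3 / 2 * (p * N) + 3 / 2 * (p * N)"
    using assms by (intro add_mono card_nbrs_typical) auto
  finally have "N \<le> 9 / 2 * (p * N)" by simp
  moreover have "p * N \<le> 1 / 5 * N" using p by (intro mult_right_mono) auto
  ultimately show False using N_pos by linarith
qed

text \<open>The eight traces on \<open>{a, b, c}\<close> have four sources: \<open>y\<close> gives
  the full set, the failed inclusions the three pairs, \<open>singles\<close> the three singletons,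
  and \<open>typical_union_nbrs\<close> the empty set.\<close>

lemma vc_dim_nbr_class_ge_3:
  assumes singles: "\<forall>v1\<in>U. \<forall>v2\<in>U. \<forall>v3\<in>U. distinct [v1, v2, v3] \<longrightarrow>
    (\<exists>u1\<in>U. \<exists>u2\<in>U. \<exists>u3\<in>U.
      adj u1 v1 \<and> \<not> adj u1 v2 \<and> \<not> adj u1 v3 \<and>
      \<not> adj u2 v1 \<and> adj u2 v2 \<and> \<not> adj u2 v3 \<and>
      \<not> adj u3 v1 \<and> \<not> adj u3 v2 \<and> adj u3 v3)"
  shows "vc_dim U (nbr_class adj U) \<ge> 3"
proof -
  obtain y a b c where y: "y \<in> U" and abc: "{a, b, c} \<subseteq> typical_nbrs y"
    and ab: "\<not> nbrs a \<inter> nbrs b \<subseteq> nbrs c" and ac: "\<not> nbrs a \<inter> nbrs c \<subseteq> nbrs b"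
    and bc: "\<not> nbrs b \<inter> nbrs c \<subseteq> nbrs a"
    by (rule uncovered_triple_exists)
  \<comment> \<open>If two of the vertices coincided, one of the failed inclusions would hold
    trivially.\<close>
  have dist: "a \<noteq> b" "a \<noteq> c" "b \<noteq> c" using ab ac bc by auto
  have inU: "{a, b, c} \<subseteq> U - atypical" using abc nbrs_subset unfolding typical_nbrs_def by blast
  have sym: "adj u v \<longleftrightarrow> adj v u" for u v using graph unfolding simple_graph_def by blast
  have "\<exists>v\<in>U. \<not> adj a v \<and> \<not> adj b v \<and> \<not> adj c v"
    using typical_union_nbrs[OF inU] by (auto simp: nbrs_def)
  moreover have "\<exists>v\<in>U. adj a v \<and> adj b v \<and> adj c v"
    using y abc sym by (auto simp: typical_nbrs_def nbrs_def)
  moreover have "\<exists>v\<in>U. adj a v \<and> adj b v \<and> \<not> adj c v" using ab by (auto simp: nbrs_def)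
  moreover have "\<exists>v\<in>U. adj a v \<and> \<not> adj b v \<and> adj c v" using ac by (auto simp: nbrs_def)
  moreover have "\<exists>v\<in>U. \<not> adj a v \<and> adj b v \<and> adj c v" using bc by (auto simp: nbrs_def)
  moreover obtain u1 u2 u3 where "u1 \<in> U" "u2 \<in> U" "u3 \<in> U"
    "adj a u1" "\<not> adj b u1" "\<not> adj c u1" "\<not> adj a u2" "adj b u2" "\<not> adj c u2"
    "\<not> adj a u3" "\<not> adj b u3" "adj c u3"
    using singles[rule_format, of a b c] dist inU sym by auto
  ultimately have traces: "\<exists>v\<in>U. (adj a v \<longleftrightarrow> P) \<and> (adj b v \<longleftrightarrow> Q) \<and> (adj c v \<longleftrightarrow> R)" for P Q R
    by (cases P; cases Q; cases R) (simp; blast)+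
  have "shatters (nbr_class adj U) {a, b, c}"
  proof (rule shatters_nbr_class)
    fix S assume "S \<subseteq> {a, b, c}"
    show "\<exists>v\<in>U. \<forall>x\<in>{a, b, c}. adj x v \<longleftrightarrow> x \<in> S"
      using traces[of "a \<in> S" "b \<in> S" "c \<in> S"] by auto
  qed (use inU in auto)
  hence "enat (card {a, b, c}) \<le> vc_dim U (nbr_class adj U)"
    using inU by (intro vc_dim_ge_cardI) auto
  moreover have "card {a, b, c} = 3" using dist by simp
  ultimately show ?thesis by (simp add: numeral_eq_enat)
qed

end

text \<open>There are no loops, so the singleton \<open>{0}\<close> deviates by
  \<open>d / n > 0\<close> at vertex 0, which the discrepancy bound with \<open>max l 0 = 0\<close>
  would forbid. Positivity later replaces \<open>max l 0\<close> by \<open>l\<close> and makes the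
  lower bound on the size of \<open>U\<close> positive.\<close>

lemma ndl_graph_eigenvalue_bound_pos:
  assumes G: "ndl_graph n d l adj" and "0 < d" "d < n"
  shows "0 < l"
proof (rule ccontr)
  assume "\<not> 0 < l"
  hence l: "max l 0 = 0" by simp
  have "\<not> adj 0 0" using G by (auto simp: ndl_graph_def regular_graph_def simple_graph_def)
  hence empty: "{w \<in> {0}. adj 0 w} = {}" by auto
  have "real (card {0::nat}) * (real d / real n)\<^sup>2
    \<le> (\<Sum>u\<in>{..<n}. (real (card {w \<in> {0}. adj u w}) - real d / real n * real (card {0::nat}))\<^sup>2)"
  proof (rule card_times_sq_le_sum)
    fix x :: nat assume "x \<in> {0}"
    hence "x = 0" by simp
    hence "card {w \<in> {0}. adj x w} = 0" unfolding \<open>x = 0\<close> empty by simp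
    thus "real d / real n
      \<le> \<bar>real (card {w \<in> {0}. adj x w}) - real d / real n * real (card {0::nat})\<bar>"
      by (simp only: of_nat_0) simp
  qed (use assms in auto)
  also have "\<dots> \<le> 0" using ndl_graph_discrepancy[OF G, of "{0}"] assms l by simp
  finally show False using assms by simp
qed

section \<open>Asymptotic form with an absolute constant\<close>

theorem theorem1p5:
  shows "\<exists>C::real. C > 0 \<and>
    (\<forall>(n :: nat \<Rightarrow> nat) (d :: nat \<Rightarrow> nat) (l :: nat \<Rightarrow> real)
      (adj :: nat \<Rightarrow> nat \<Rightarrow> nat \<Rightarrow> bool) (U :: nat \<Rightarrow> nat set).
      filterlim n at_top sequentially \<longrightarrow>
      (\<lambda>k. real (d k)) \<in> o(\<lambda>k. real (n k)) \<longrightarrow>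
      (\<forall>k. d k > 0) \<longrightarrow>
      (\<forall>k. ndl_graph (n k) (d k) (l k) (adj k)) \<longrightarrow>
      (\<forall>k. U k \<subseteq> {..<n k}) \<longrightarrow>
      (\<forall>k. \<forall>v1\<in>U k. \<forall>v2\<in>U k. \<forall>v3\<in>U k. distinct [v1, v2, v3] \<longrightarrow>
        (\<exists>u1\<in>U k. \<exists>u2\<in>U k. \<exists>u3\<in>U k.
          adj k u1 v1 \<and> \<not> adj k u1 v2 \<and> \<not> adj k u1 v3 \<and>
          \<not> adj k u2 v1 \<and> adj k u2 v2 \<and> \<not> adj k u2 v3 \<and>
          \<not> adj k u3 v1 \<and> \<not> adj k u3 v2 \<and> adj k u3 v3)) \<longrightarrow>
      (\<forall>k. real (card (U k)) \<ge>
        C * max (l k powr (2/3) * (real (n k) / real (d k))\<^sup>2)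
                (l k * (real (n k) / real (d k)) powr (13/7))) \<longrightarrow>
      (\<forall>\<^sub>F k in sequentially. vc_dim (U k) (nbr_class (adj k) (U k)) \<ge> 3))"
proof (intro exI[of _ 40] conjI allI impI)
  fix n d :: "nat \<Rightarrow> nat" and l :: "nat \<Rightarrow> real" and adj :: "nat \<Rightarrow> nat \<Rightarrow> nat \<Rightarrow> bool"
    and U :: "nat \<Rightarrow> nat set"
  assume small: "(\<lambda>k. real (d k)) \<in> o(\<lambda>k. real (n k))" and dpos: "\<forall>k. d k > 0"
    and G: "\<forall>k. ndl_graph (n k) (d k) (l k) (adj k)" and U: "\<forall>k. U k \<subseteq> {..<n k}"
    and singles: "\<forall>k. \<forall>v1\<in>U k. \<forall>v2\<in>U k. \<forall>v3\<in>U k. distinct [v1, v2, v3] \<longrightarrow>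
        (\<exists>u1\<in>U k. \<exists>u2\<in>U k. \<exists>u3\<in>U k.
          adj k u1 v1 \<and> \<not> adj k u1 v2 \<and> \<not> adj k u1 v3 \<and>
          \<not> adj k u2 v1 \<and> adj k u2 v2 \<and> \<not> adj k u2 v3 \<and>
          \<not> adj k u3 v1 \<and> \<not> adj k u3 v2 \<and> adj k u3 v3)"
    and size: "\<forall>k. real (card (U k)) \<ge>
        40 * max (l k powr (2/3) * (real (n k) / real (d k))\<^sup>2)
                (l k * (real (n k) / real (d k)) powr (13/7))"
  \<comment> \<open>The hypothesis \<open>d = o(n)\<close> enters as density at most 1/5 for all
    large \<open>k\<close>; from there on \<open>k\<close> is fixed.\<close>
  have "\<forall>\<^sub>F k in sequentially. norm (real (d k)) \<le> 1 / 5 * norm (real (n k))"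
    by (rule landau_o.smallD[OF small]) simp
  thus "\<forall>\<^sub>F k in sequentially. vc_dim (U k) (nbr_class (adj k) (U k)) \<ge> 3"
  proof eventually_elim
    case (elim k)
    define p r where "p = real (d k) / real (n k)" and "r = real (n k) / real (d k)"
    have d: "d k > 0" using dpos by simp
    hence n: "n k > 0" "d k < n k" using elim by (auto intro: Nat.gr0I)
    have l: "l k > 0" by (rule ndl_graph_eigenvalue_bound_pos[OF G[rule_format] d n(2)])
    have p: "0 < p" "p \<le> 1 / 5" using d n elim unfolding p_def by (auto simp: field_simps)
    have r: "r \<ge> 1" "p * r = 1" using d n unfolding r_def p_def by auto
    \<comment> \<open>The exponent 3/2 is the one in the locale assumption; since
      \<open>r \<ge> 1\<close> and 3/2 \<le> 13/7, the second term of the maximum dominates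
      it.\<close>
    have "40 * (l k * r powr (3/2)) \<le> 40 * (l k * r powr (13/7))"
      using l r by (intro mult_left_mono powr_mono) auto
    also have "\<dots> \<le> real (card (U k))" using size[rule_format, of k] unfolding r_def by linarith
    finally have N: "40 * (l k * r powr (3/2)) \<le> real (card (U k))" .
    have pos: "40 * (l k * r powr (3/2)) > 0" using l r by simp
    have "(r powr (3/2))\<^sup>2 = r powr 3" using r by (simp add: powr_power)
    hence r3: "(r powr (3/2))\<^sup>2 = r ^ 3" using r by (simp add: powr_numeral)
    \<comment> \<open>With 40^2 = 1600 and \<open>p * r = 1\<close>, the size bound \<open>N\<close>
      becomes the last assumption of the locale.\<close>
    have "1600 * (l k)\<^sup>2 = p ^ 3 * r ^ 3 * (1600 * (l k)\<^sup>2)"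
      using r(2) by (simp add: power_mult_distrib[symmetric])
    also have "\<dots> = p ^ 3 * (40 * (l k * r powr (3/2)))\<^sup>2" using r3 by (simp add: power_mult_distrib)
    also have "\<dots> \<le> p ^ 3 * (real (card (U k)))\<^sup>2"
      using N pos p by (intro mult_left_mono power_mono) auto
    finally have bound: "1600 * (l k)\<^sup>2 \<le> p ^ 3 * (real (card (U k)))\<^sup>2" .
    interpret discrepancy_graph "n k" "adj k" p "l k" "U k"
    proof
      show "simple_graph (n k) (adj k)" using G by (simp add: ndl_graph_def regular_graph_def)
      show "(\<Sum>u<n k. (real (card {w \<in> W. adj k u w}) - p * real (card W))\<^sup>2)
          \<le> (l k)\<^sup>2 * real (card W)" if "W \<subseteq> {..<n k}" for W
        using ndl_graph_discrepancy[OF G[rule_format] that] l unfolding p_def by simp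
      show "U k \<noteq> {}" using N pos by auto
    qed (use p U bound in auto)
    show ?case using singles by (intro vc_dim_nbr_class_ge_3) blast
  qed
qed simp

end
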